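(* Let $n\ge 1$ be an integer. If $f:X\to Y$ is a function of metric spaces that is coarsely $n$-to-1 and coarsely surjective, then $X$ has asymptotic property C if and only if $Y$ has asymptotic property C.
   Context: A function $f:X\to Y$ of metric spaces is bornologous if there is a function $E:[0,\infty)\to[0,\infty)$ such that the image of every subset of $X$ of diameter at most $r$ has diameter at most $E(r)$. A bornologous function $f:X\to Y$ is coarsely $n$-to-1 (with control $C$) if there is a function $C:[0,\infty)\to[0,\infty)$ such that for each subset $B$ of $Y$ with $\mathrm{diam}(B)\le r$ one has $f^{-1}(B)=\bigcup_{i=1}^n A_i$ for some subsets $A_i$ of $X$ with $\mathrm{diam}(A_i)<C(r)$ for $i=1,\dots,n$. (In particular a coarsely $n$-to-1 function is bornologous.) For $A\subset Y$ and $R>0$, $B(A,R)$ consists of $A$ and all points at distance less than $R$ from some point of $A$. $f:X\to Y$ is coarsely surjective if $Y\subset B(f(X),R)$ for some $R>0$. A family of subsets is $R$-disjoint if $d(x,y)\ge R$ whenever $x$ and $y$ belong to different elements of the family; it is uniformly bounded if the diameters of its members have a common finite upper bound. A metric space $X$ has asymptotic property C if for every sequence $R_1<R_2<\ldots$ of positive real numbers there exist $m\in\mathbb{N}$ and uniformly bounded families $\mathcal{U}_1,\dots,\mathcal{U}_m$ of subsets of $X$ such that $\mathcal{U}_i$ is $R_i$-disjoint for $1\le i\le m$ and the members of $\mathcal{U}_1,\dots,\mathcal{U}_m$ together cover $X$. *)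

theory Defs
  imports "HOL-Analysis.Analysis"
begin

text \<open>
  Diameters take values in the extended non-negative reals, so that unbounded sets have
  diameter \<open>\<infinity>\<close>; the empty set has diameter 0.
  (The library's \<open>diameter\<close> is real-valued and bound to the type class \<open>metric_space\<close>.)
\<close>

definition mdiam :: "'a metric \<Rightarrow> 'a set \<Rightarrow> ennreal" where
  "mdiam M A = (SUP x\<in>A. SUP y\<in>A. ennreal (mdist M x y))"

definition bornologous :: "'a metric \<Rightarrow> 'b metric \<Rightarrow> ('a \<Rightarrow> 'b) \<Rightarrow> bool" where
  "bornologous X Y f \<longleftrightarrow>
     f \<in> mspace X \<rightarrow> mspace Y \<and>
     (\<exists>E \<in> {0::real..} \<rightarrow> {0::real..}.
        \<forall>r\<ge>0. \<forall>A \<subseteq> mspace X.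
          mdiam X A \<le> ennreal r \<longrightarrow> mdiam Y (f ` A) \<le> ennreal (E r))"

definition coarsely_n_to_1 :: "nat \<Rightarrow> 'a metric \<Rightarrow> 'b metric \<Rightarrow> ('a \<Rightarrow> 'b) \<Rightarrow> bool" where
  "coarsely_n_to_1 n X Y f \<longleftrightarrow>
     bornologous X Y f \<and>
     (\<exists>C \<in> {0::real..} \<rightarrow> {0::real..}.
        \<forall>r\<ge>0. \<forall>B \<subseteq> mspace Y.
          mdiam Y B \<le> ennreal r \<longrightarrow>
          (\<exists>A :: nat \<Rightarrow> 'a set.
             f -` B \<inter> mspace X = (\<Union>i<n. A i) \<and>
             (\<forall>i<n. mdiam X (A i) < ennreal (C r))))"

definition mneighbourhood :: "'a metric \<Rightarrow> 'a set \<Rightarrow> real \<Rightarrow> 'a set" where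
  "mneighbourhood M A R = A \<union> (\<Union>a\<in>A. mball_of M a R)"

definition coarsely_surjective :: "'a metric \<Rightarrow> 'b metric \<Rightarrow> ('a \<Rightarrow> 'b) \<Rightarrow> bool" where
  "coarsely_surjective X Y f \<longleftrightarrow>
     (\<exists>R>0. mspace Y \<subseteq> mneighbourhood Y (f ` mspace X) R)"

definition R_disjoint :: "'a metric \<Rightarrow> real \<Rightarrow> 'a set set \<Rightarrow> bool" where
  "R_disjoint M R \<U> \<longleftrightarrow>
     (\<forall>U\<in>\<U>. \<forall>V\<in>\<U>. U \<noteq> V \<longrightarrow> (\<forall>x\<in>U. \<forall>y\<in>V. R \<le> mdist M x y))"

definition uniformly_bounded :: "'a metric \<Rightarrow> 'a set set \<Rightarrow> bool" where
  "uniformly_bounded M \<U> \<longleftrightarrow> (\<exists>D<\<infinity>. \<forall>U\<in>\<U>. mdiam M U \<le> D)"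

text \<open>Sequences and families are indexed from 0 instead of from 1.\<close>

definition asymptotic_property_C :: "'a metric \<Rightarrow> bool" where
  "asymptotic_property_C M \<longleftrightarrow>
     (\<forall>R :: nat \<Rightarrow> real. (\<forall>i. 0 < R i) \<and> strict_mono R \<longrightarrow>
        (\<exists>(m::nat) (\<U> :: nat \<Rightarrow> 'a set set).
           (\<forall>i<m. \<U> i \<subseteq> Pow (mspace M) \<and>
                  uniformly_bounded M (\<U> i) \<and> R_disjoint M (R i) (\<U> i)) \<and>
           mspace M = (\<Union>i<m. \<Union>(\<U> i))))"

end

theory Submission
  imports Defs
begin

text \<open>
  From \<open>Y\<close> to \<open>X\<close>: the preimage of a bounded set is a union of \<open>n\<close> sets of controlled diameter, so
  merging those at distance less than \<open>R\<close> leaves \<open>R\<close>-disjoint pieces of controlled diameter, while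
  pieces of different preimages are far apart because \<open>f\<close> is bornologous.

  From \<open>X\<close> to \<open>Y\<close>: if a family in \<open>X\<close> is sufficiently disjoint, a large ball of \<open>Y\<close> meets at most \<open>n\<close>
  of the images of its members. Choose thresholds \<open>t\<^sub>0 < \<dots> < t\<^sub>n\<close> with large gaps. For each \<open>y\<close> close
  to some image, two consecutive thresholds select the same nonempty set \<open>T\<close> of images near \<open>y\<close>.
  Sorting the points by the index of such a gap and by \<open>T\<close> replaces the family by \<open>n\<close> uniformly
  bounded families, disjoint at the size of the gaps. A single family in \<open>X\<close> is thus used to
  serve \<open>n\<close> consecutive terms of the sequence \<open>R\<close>.
\<close>

section \<open>Diameters and control functions expressed through pairwise distances\<close>

lemma mdist_self: "x \<in> mspace M \<Longrightarrow> mdist M x x = 0"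
  by simp

text \<open>The sign condition matters because \<open>ennreal\<close> sends negative numbers to 0: a
  singleton has diameter 0, but its distances are not bounded by a negative
  \<open>r\<close>.\<close>

lemma mdiam_le_iff:
  assumes "0 \<le> r"
  shows "mdiam M A \<le> ennreal r \<longleftrightarrow> (\<forall>x\<in>A. \<forall>y\<in>A. mdist M x y \<le> r)"
  using assms unfolding mdiam_def by (simp add: SUP_le_iff)

lemma mdist_less_of_mdiam_less:
  assumes "mdiam M A < ennreal c" "x \<in> A" "y \<in> A"
  shows "mdist M x y < c"
proof -
  have "ennreal (mdist M x y) \<le> mdiam M A"
    unfolding mdiam_def using assms(2,3) by (meson SUP_upper2 order_refl)
  then show ?thesis
    using assms(1) by (metis ennreal_less_iff mdist_nonneg order_le_less_trans)
qed

lemma uniformly_bounded_iff: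
  "uniformly_bounded M \<U> \<longleftrightarrow> (\<exists>D\<ge>0. \<forall>U\<in>\<U>. \<forall>x\<in>U. \<forall>y\<in>U. mdist M x y \<le> D)"
proof
  assume "uniformly_bounded M \<U>"
  then obtain D where D: "D < \<infinity>" "\<forall>U\<in>\<U>. mdiam M U \<le> D"
    unfolding uniformly_bounded_def by auto
  then have "mdiam M U \<le> ennreal (enn2real D)" if "U \<in> \<U>" for U
    using that by simp
  then show "\<exists>D\<ge>0. \<forall>U\<in>\<U>. \<forall>x\<in>U. \<forall>y\<in>U. mdist M x y \<le> D"
    by (intro exI[of _ "enn2real D"]) (simp add: mdiam_le_iff)
next
  assume "\<exists>D\<ge>0. \<forall>U\<in>\<U>. \<forall>x\<in>U. \<forall>y\<in>U. mdist M x y \<le> D"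
  then obtain D where "0 \<le> D" "\<forall>U\<in>\<U>. mdiam M U \<le> ennreal D"
    by (auto simp: mdiam_le_iff)
  then show "uniformly_bounded M \<U>"
    unfolding uniformly_bounded_def by (intro exI[of _ "ennreal D"]) simp
qed

lemma R_disjointD:
  "\<lbrakk>R_disjoint M R \<U>; U \<in> \<U>; V \<in> \<U>; U \<noteq> V; x \<in> U; y \<in> V\<rbrakk> \<Longrightarrow> R \<le> mdist M x y"
  by (simp add: R_disjoint_def)

lemma R_disjoint_antimono: "\<lbrakk>R_disjoint M S \<U>; R \<le> S\<rbrakk> \<Longrightarrow> R_disjoint M R \<U>"
  unfolding R_disjoint_def by force

text \<open>Applying the diameter control to the two-point set \<open>{x, y}\<close> gives a bound
  for a single pair, the only form in which it is used below.\<close>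

lemma bornologous_control:
  assumes "bornologous X Y f"
  obtains E where "\<And>r. 0 \<le> r \<Longrightarrow> 0 \<le> E r"
    and "\<And>r x y. \<lbrakk>0 \<le> r; x \<in> mspace X; y \<in> mspace X; mdist X x y \<le> r\<rbrakk>
           \<Longrightarrow> mdist Y (f x) (f y) \<le> E r"
proof -
  obtain E where E: "E \<in> {0..} \<rightarrow> {0..}"
    and EA: "\<And>r A. \<lbrakk>0 \<le> r; A \<subseteq> mspace X; mdiam X A \<le> ennreal r\<rbrakk>
              \<Longrightarrow> mdiam Y (f ` A) \<le> ennreal (E r)"
    using assms unfolding bornologous_def by meson
  have nonneg: "0 \<le> E r" if "0 \<le> r" for r
    using E that by auto
  have "mdist Y (f x) (f y) \<le> E r"
    if "0 \<le> r" "x \<in> mspace X" "y \<in> mspace X" "mdist X x y \<le> r" for r x y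
  proof -
    have "mdiam X {x, y} \<le> ennreal r"
      using that by (auto simp: mdiam_le_iff mdist_self mdist_commute[of X y x])
    then have "mdiam Y (f ` {x, y}) \<le> ennreal (E r)"
      using EA[of r "{x, y}"] that by auto
    then show ?thesis
      by (simp add: mdiam_le_iff nonneg[OF that(1)])
  qed
  with nonneg show ?thesis
    by (rule that)
qed

text \<open>Moves the control from diameters to pairwise distances, so that the geometric arguments
  can be carried out with real numbers.\<close>

lemma coarsely_n_to_1_control:
  assumes "coarsely_n_to_1 n X Y f"
  obtains C where "\<And>r. 0 \<le> r \<Longrightarrow> 0 \<le> C r"
    and "\<And>r B. \<lbrakk>0 \<le> r; B \<subseteq> mspace Y; \<And>x y. \<lbrakk>x \<in> B; y \<in> B\<rbrakk> \<Longrightarrow> mdist Y x y \<le> r\<rbrakk>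
           \<Longrightarrow> \<exists>A :: nat \<Rightarrow> _ set. f -` B \<inter> mspace X = (\<Union>i<n. A i) \<and>
                 (\<forall>i<n. \<forall>x\<in>A i. \<forall>y\<in>A i. mdist X x y < C r)"
proof -
  obtain C where C: "C \<in> {0::real..} \<rightarrow> {0::real..}"
    and CB: "\<forall>r\<ge>0. \<forall>B \<subseteq> mspace Y. mdiam Y B \<le> ennreal r \<longrightarrow>
          (\<exists>A :: nat \<Rightarrow> 'a set. f -` B \<inter> mspace X = (\<Union>i<n. A i) \<and>
             (\<forall>i<n. mdiam X (A i) < ennreal (C r)))"
    using assms unfolding coarsely_n_to_1_def by (elim conjE bexE)
  show ?thesis
  proof (rule that)
    show "0 \<le> C r" if "0 \<le> r" for r
      using C that by auto
    fix r B
    assume "0 \<le> r" "B \<subseteq> mspace Y" "\<And>x y. \<lbrakk>x \<in> B; y \<in> B\<rbrakk> \<Longrightarrow> mdist Y x y \<le> r"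
    then obtain A :: "nat \<Rightarrow> 'a set" where "f -` B \<inter> mspace X = (\<Union>i<n. A i)"
      and "\<forall>i<n. mdiam X (A i) < ennreal (C r)"
      using CB[rule_format, of r B] by (auto simp: mdiam_le_iff)
    then show "\<exists>A :: nat \<Rightarrow> 'a set. f -` B \<inter> mspace X = (\<Union>i<n. A i) \<and>
                 (\<forall>i<n. \<forall>x\<in>A i. \<forall>y\<in>A i. mdist X x y < C r)"
      using mdist_less_of_mdiam_less by meson
  qed
qed

text \<open>Partial sums of \<open>\<bar>g j\<bar> + 1\<close> work. Property C accepts only
  positive increasing sequences, while the bounds produced by control functions need not be
  monotone.\<close>

lemma strict_mono_pos_above:
  fixes g :: "nat \<Rightarrow> real"
  obtains S where "strict_mono S" "\<And>i. 0 < S i" "\<And>i. g i < S i"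
proof
  let ?S = "\<lambda>i. \<Sum>j\<le>i. \<bar>g j\<bar> + 1"
  show "strict_mono ?S"
    by (rule strict_monoI_Suc) simp
  have "\<bar>g i\<bar> + 1 \<le> ?S i" for i
    by (rule member_le_sum) auto
  then show "0 < ?S i" "g i < ?S i" for i
    by (smt (verit, best))+
qed

lemma asymptotic_property_CE:
  fixes S :: "nat \<Rightarrow> real"
  assumes C: "asymptotic_property_C M" and S: "\<And>i. 0 < S i" "strict_mono S"
  obtains m :: nat and \<U> where
    "\<And>i. i < m \<Longrightarrow> \<U> i \<subseteq> Pow (mspace M) \<and> uniformly_bounded M (\<U> i) \<and> R_disjoint M (S i) (\<U> i)"
    "mspace M = (\<Union>i<m. \<Union>(\<U> i))"
proof -
  have "(\<forall>i. 0 < S i) \<and> strict_mono S"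
    using S by simp
  from C[unfolded asymptotic_property_C_def, THEN spec, THEN mp, OF this]
  obtain m \<U> where
    "\<forall>i<m. \<U> i \<subseteq> Pow (mspace M) \<and> uniformly_bounded M (\<U> i) \<and> R_disjoint M (S i) (\<U> i)"
    "mspace M = (\<Union>i<m. \<Union>(\<U> i))"
    by (elim exE conjE)
  then show ?thesis
    by (intro that[of m \<U>]) simp_all
qed

section \<open>Merging finitely many bounded sets into disjoint pieces\<close>

text \<open>Induction on \<open>n\<close>: the new set absorbs every earlier piece closer than
  \<open>R\<close> to it, and the remaining pieces are untouched. The bound \<open>D\<close> is
  fixed before the sets \<open>A\<close>, so one value serves the preimages of all members of a
  family.\<close>

lemma merge_into_R_disjoint:
  fixes M :: "'a metric" and n :: nat
  assumes "0 < R" "0 \<le> c"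
  obtains D where "0 \<le> D"
    and "\<And>A. \<lbrakk>\<And>i. i < n \<Longrightarrow> A i \<subseteq> mspace M;
              \<And>i x y. \<lbrakk>i < n; x \<in> A i; y \<in> A i\<rbrakk> \<Longrightarrow> mdist M x y \<le> c\<rbrakk>
           \<Longrightarrow> \<exists>\<F>. \<Union>\<F> = (\<Union>i<n. A i) \<and> R_disjoint M R \<F> \<and>
                 (\<forall>F\<in>\<F>. \<forall>x\<in>F. \<forall>y\<in>F. mdist M x y \<le> D)"
proof -
  have "\<exists>D\<ge>0. \<forall>A. (\<forall>i<n. A i \<subseteq> mspace M \<and> (\<forall>x\<in>A i. \<forall>y\<in>A i. mdist M x y \<le> c)) \<longrightarrow>
          (\<exists>\<F>. \<Union>\<F> = (\<Union>i<n. A i) \<and> R_disjoint M R \<F> \<and>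
                 (\<forall>F\<in>\<F>. \<forall>x\<in>F. \<forall>y\<in>F. mdist M x y \<le> D))"
  proof (induction n)
    case 0
    have "R_disjoint M R {}"
      by (simp add: R_disjoint_def)
    then show ?case
      by (intro exI[of _ 0] conjI allI impI exI[of _ "{}"]) auto
  next
    case (Suc n)
    then obtain D where D: "0 \<le> D"
      and IH: "\<forall>A. (\<forall>i<n. A i \<subseteq> mspace M \<and> (\<forall>x\<in>A i. \<forall>y\<in>A i. mdist M x y \<le> c)) \<longrightarrow>
          (\<exists>\<F>. \<Union>\<F> = (\<Union>i<n. A i) \<and> R_disjoint M R \<F> \<and>
                 (\<forall>F\<in>\<F>. \<forall>x\<in>F. \<forall>y\<in>F. mdist M x y \<le> D))"
      by (elim exE conjE)
    \<comment> \<open>Each point of the merged piece is within \<open>D + R\<close> of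
      \<open>A n\<close>, whose own diameter is at most \<open>c\<close>; a path between two such
      points has length at most \<open>(D + R) + c + (D + R)\<close>.\<close>
    let ?D = "2 * D + 2 * R + c"
    show ?case
    proof (intro exI[of _ ?D] conjI allI impI)
      show "0 \<le> ?D"
        using D assms by simp
      fix A
      assume A: "\<forall>i<Suc n. A i \<subseteq> mspace M \<and> (\<forall>x\<in>A i. \<forall>y\<in>A i. mdist M x y \<le> c)"
      then obtain \<F> where \<F>: "\<Union>\<F> = (\<Union>i<n. A i)" "R_disjoint M R \<F>"
        and FD: "\<And>F x y. \<lbrakk>F \<in> \<F>; x \<in> F; y \<in> F\<rbrakk> \<Longrightarrow> mdist M x y \<le> D"
        using IH[rule_format, of A] by (auto simp: less_Suc_eq)
      \<comment> \<open>\<open>\<N>\<close> collects the pieces to be absorbed, and \<open>P\<close>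
        is the result of the absorption.\<close>
      define \<N> where "\<N> = {F \<in> \<F>. \<exists>x\<in>F. \<exists>y\<in>A n. mdist M x y < R}"
      define P where "P = A n \<union> \<Union>\<N>"
      have sub: "F \<subseteq> mspace M" if "F \<in> \<F>" for F
      proof -
        have "F \<subseteq> (\<Union>i<n. A i)"
          using \<F>(1) that by blast
        also have "\<dots> \<subseteq> mspace M"
          using A by (simp add: UN_subset_iff)
        finally show ?thesis .
      qed
      have An: "A n \<subseteq> mspace M" "\<And>x y. \<lbrakk>x \<in> A n; y \<in> A n\<rbrakk> \<Longrightarrow> mdist M x y \<le> c"
        using A by auto
      have PM: "P \<subseteq> mspace M"
        using sub An unfolding P_def \<N>_def by blast
      \<comment> \<open>A point of an absorbed piece first moves inside that piece, by at most
        \<open>D\<close>, and then jumps to \<open>A n\<close>, by less than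
        \<open>R\<close>.\<close>
      have near: "\<exists>a\<in>A n. mdist M x a \<le> D + R" if xP: "x \<in> P" for x
      proof (cases "x \<in> A n")
        case True
        then show ?thesis
          using An(1) D assms by (intro bexI[of _ x]) (auto simp: mdist_self)
      next
        case False
        then obtain F where "F \<in> \<N>" and x: "x \<in> F"
          using xP unfolding P_def by blast
        then obtain z a where F: "F \<in> \<F>" "z \<in> F" "a \<in> A n" "mdist M z a < R"
          unfolding \<N>_def by blast
        then have "mdist M x a \<le> mdist M x z + mdist M z a"
          using sub An x by (intro mdist_triangle) auto
        then show ?thesis
          using F x FD[of F x z] by (intro bexI[of _ a]) auto
      qed
      have PD: "mdist M x y \<le> ?D" if xy: "x \<in> P" "y \<in> P" for x y
      proof -
        obtain a b where ab: "a \<in> A n" "mdist M x a \<le> D + R" "b \<in> A n" "mdist M y b \<le> D + R"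
          using near[OF xy(1)] near[OF xy(2)] by blast
        have "mdist M x y \<le> mdist M x a + mdist M a y"
          "mdist M a y \<le> mdist M a b + mdist M b y"
          using ab xy PM An(1) by (intro mdist_triangle; blast)+
        then show ?thesis
          using ab An(2)[of a b] by (simp add: mdist_commute)
      qed
      \<comment> \<open>No further absorption is triggered: points of \<open>A n\<close> are far
        from \<open>F\<close> because \<open>F\<close> is not in \<open>\<N>\<close>, and points of
        absorbed pieces because \<open>\<F>\<close> was already \<open>R\<close>-disjoint.\<close>
      have Pfar: "R \<le> mdist M x y" if xy: "x \<in> P" "y \<in> F" "F \<in> \<F> - \<N>" for x y F
        using xy(1) unfolding P_def
      proof (elim UnE UnionE)
        assume "x \<in> A n"
        then have "\<not> mdist M y x < R"
          using xy unfolding \<N>_def by blast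
        then show ?thesis
          by (simp add: mdist_commute)
      next
        fix F'
        assume F': "x \<in> F'" "F' \<in> \<N>"
        then have "F' \<in> \<F>"
          by (simp add: \<N>_def)
        moreover have "F' \<noteq> F" "F \<in> \<F>"
          using F'(2) xy(3) by auto
        ultimately show ?thesis
          by (intro R_disjointD[OF \<F>(2) _ _ _ F'(1) xy(2)])
      qed
      have "\<N> \<union> (\<F> - \<N>) = \<F>"
        by (auto simp: \<N>_def)
      moreover have "\<Union>(insert P (\<F> - \<N>)) = A n \<union> \<Union>(\<N> \<union> (\<F> - \<N>))"
        unfolding P_def Union_insert Union_Un_distrib by (rule Un_assoc)
      ultimately have "\<Union>(insert P (\<F> - \<N>)) = (\<Union>i<Suc n. A i)"
        using \<F>(1) by (simp add: lessThan_Suc)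
      moreover have "R_disjoint M R (insert P (\<F> - \<N>))"
        unfolding R_disjoint_def
      proof (intro ballI impI)
        fix U V x y
        assume UV: "U \<in> insert P (\<F> - \<N>)" "V \<in> insert P (\<F> - \<N>)" "U \<noteq> V"
          and xy: "x \<in> U" "y \<in> V"
        then consider "U = P" "V \<in> \<F> - \<N>" | "V = P" "U \<in> \<F> - \<N>" | "U \<in> \<F>" "V \<in> \<F>"
          by blast
        then show "R \<le> mdist M x y"
        proof cases
          case 1
          then show ?thesis
            using Pfar[of x y V] xy by simp
        next
          case 2
          then show ?thesis
            using Pfar[of y x U] xy by (simp add: mdist_commute)
        next
          case 3
          then show ?thesis
            by (rule R_disjointD[OF \<F>(2) _ _ UV(3) xy])
        qed
      qed
      moreover have "\<forall>F\<in>insert P (\<F> - \<N>). \<forall>x\<in>F. \<forall>y\<in>F. mdist M x y \<le> ?D"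
      proof (intro ballI)
        fix F x y
        assume "F \<in> insert P (\<F> - \<N>)" "x \<in> F" "y \<in> F"
        then consider "x \<in> P" "y \<in> P" | "mdist M x y \<le> D"
          using FD by blast
        then show "mdist M x y \<le> ?D"
          using PD D assms by cases auto
      qed
      ultimately show "\<exists>\<F>. \<Union>\<F> = (\<Union>i<Suc n. A i) \<and> R_disjoint M R \<F> \<and>
                 (\<forall>F\<in>\<F>. \<forall>x\<in>F. \<forall>y\<in>F. mdist M x y \<le> ?D)"
        by blast
    qed
  qed
  then obtain D where "0 \<le> D"
    and "\<forall>A. (\<forall>i<n. A i \<subseteq> mspace M \<and> (\<forall>x\<in>A i. \<forall>y\<in>A i. mdist M x y \<le> c)) \<longrightarrow>
          (\<exists>\<F>. \<Union>\<F> = (\<Union>i<n. A i) \<and> R_disjoint M R \<F> \<and>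
                 (\<forall>F\<in>\<F>. \<forall>x\<in>F. \<forall>y\<in>F. mdist M x y \<le> D))"
    by (elim exE conjE)
  then show ?thesis
    by (intro that[of D]) simp_all
qed

section \<open>From the codomain to the domain\<close>

lemma asymptotic_property_C_pullback:
  assumes f: "f \<in> mspace X \<rightarrow> mspace Y" and n1: "coarsely_n_to_1 n X Y f"
    and Y: "asymptotic_property_C Y"
  shows "asymptotic_property_C X"
  unfolding asymptotic_property_C_def
proof (intro allI impI)
  fix R :: "nat \<Rightarrow> real"
  assume R: "(\<forall>i. 0 < R i) \<and> strict_mono R"
  have "bornologous X Y f"
    using n1 by (simp add: coarsely_n_to_1_def)
  then obtain E where E: "\<And>r x y. \<lbrakk>0 \<le> r; x \<in> mspace X; y \<in> mspace X; mdist X x y \<le> r\<rbrakk>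
           \<Longrightarrow> mdist Y (f x) (f y) \<le> E r"
    using bornologous_control by metis
  \<comment> \<open>Points of \<open>X\<close> at distance at most \<open>R i\<close> have images at
    distance at most \<open>E (R i) < S i\<close>. Hence preimages of distinct members of an
    \<open>S i\<close>-disjoint family are more than \<open>R i\<close> apart.\<close>
  obtain S :: "nat \<Rightarrow> real" where S: "strict_mono S" "\<And>i. 0 < S i" "\<And>i. E (R i) < S i"
    using strict_mono_pos_above[of "\<lambda>i. E (R i)"] by metis
  obtain m \<U> where \<U>: "\<And>i. i < m \<Longrightarrow> \<U> i \<subseteq> Pow (mspace Y) \<and>
         uniformly_bounded Y (\<U> i) \<and> R_disjoint Y (S i) (\<U> i)"
    and cover: "mspace Y = (\<Union>i<m. \<Union>(\<U> i))"
    by (fact asymptotic_property_CE[OF Y S(2,1)])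
  have "\<exists>\<V>. \<V> \<subseteq> Pow (mspace X) \<and> uniformly_bounded X \<V> \<and> R_disjoint X (R i) \<V> \<and>
          f -` \<Union>(\<U> i) \<inter> mspace X \<subseteq> \<Union>\<V>" if i: "i < m" for i
  proof -
    obtain d where d: "0 \<le> d" "\<And>B x y. \<lbrakk>B \<in> \<U> i; x \<in> B; y \<in> B\<rbrakk> \<Longrightarrow> mdist Y x y \<le> d"
      using \<U>[OF i] unfolding uniformly_bounded_iff by metis
    obtain C where C: "\<And>r. 0 \<le> r \<Longrightarrow> 0 \<le> C r"
      and CB: "\<And>r B. \<lbrakk>0 \<le> r; B \<subseteq> mspace Y; \<And>x y. \<lbrakk>x \<in> B; y \<in> B\<rbrakk> \<Longrightarrow> mdist Y x y \<le> r\<rbrakk>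
           \<Longrightarrow> \<exists>A :: nat \<Rightarrow> 'a set. f -` B \<inter> mspace X = (\<Union>i<n. A i) \<and>
                 (\<forall>i<n. \<forall>x\<in>A i. \<forall>y\<in>A i. mdist X x y < C r)"
      by (fact coarsely_n_to_1_control[OF n1])
    have Ri: "0 < R i"
      using R by blast
    \<comment> \<open>\<open>C d\<close> bounds the pieces of the preimage of any member of
      \<open>\<U> i\<close>, so \<open>D\<close> does not depend on the member \<open>B\<close>
      chosen next. This makes the union of all the merged families uniformly bounded.\<close>
    obtain D where D: "0 \<le> D"
      and merge: "\<And>A. \<lbrakk>\<And>j. j < n \<Longrightarrow> A j \<subseteq> mspace X;
              \<And>j x y. \<lbrakk>j < n; x \<in> A j; y \<in> A j\<rbrakk> \<Longrightarrow> mdist X x y \<le> C d\<rbrakk>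
           \<Longrightarrow> \<exists>\<F>. \<Union>\<F> = (\<Union>j<n. A j) \<and> R_disjoint X (R i) \<F> \<and>
                 (\<forall>F\<in>\<F>. \<forall>x\<in>F. \<forall>y\<in>F. mdist X x y \<le> D)"
      by (fact merge_into_R_disjoint[OF Ri C[OF d(1)], of n X])
    have "\<exists>\<F>. \<Union>\<F> = f -` B \<inter> mspace X \<and> R_disjoint X (R i) \<F> \<and>
                 (\<forall>F\<in>\<F>. \<forall>x\<in>F. \<forall>y\<in>F. mdist X x y \<le> D)" if B: "B \<in> \<U> i" for B
    proof -
      have "B \<subseteq> mspace Y"
        using B \<U>[OF i] by auto
      then obtain A where A: "f -` B \<inter> mspace X = (\<Union>j<n. A j)"
        "\<forall>j<n. \<forall>x\<in>A j. \<forall>y\<in>A j. mdist X x y < C d"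
        using CB[OF d(1), of B] d(2)[OF B] by auto
      have "A j \<subseteq> mspace X" if "j < n" for j
      proof -
        have "A j \<subseteq> (\<Union>j<n. A j)"
          using that by blast
        then show ?thesis
          by (simp flip: A(1))
      qed
      with A merge[of A] show ?thesis
        by (simp add: less_imp_le)
    qed
    then have "\<forall>B. \<exists>\<F>. B \<in> \<U> i \<longrightarrow> \<Union>\<F> = f -` B \<inter> mspace X \<and> R_disjoint X (R i) \<F> \<and>
                 (\<forall>F\<in>\<F>. \<forall>x\<in>F. \<forall>y\<in>F. mdist X x y \<le> D)"
      by simp
    from choice[OF this] obtain \<F> where "\<forall>B. B \<in> \<U> i \<longrightarrow> \<Union>(\<F> B) = f -` B \<inter> mspace X \<and>
        R_disjoint X (R i) (\<F> B) \<and> (\<forall>F\<in>\<F> B. \<forall>x\<in>F. \<forall>y\<in>F. mdist X x y \<le> D)" ..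
    then have \<F>: "\<And>B. B \<in> \<U> i \<Longrightarrow> \<Union>(\<F> B) = f -` B \<inter> mspace X"
      "\<And>B. B \<in> \<U> i \<Longrightarrow> R_disjoint X (R i) (\<F> B)"
      "\<And>B F x y. \<lbrakk>B \<in> \<U> i; F \<in> \<F> B; x \<in> F; y \<in> F\<rbrakk> \<Longrightarrow> mdist X x y \<le> D"
      by simp_all
    let ?\<V> = "\<Union>B\<in>\<U> i. \<F> B"
    have "?\<V> \<subseteq> Pow (mspace X)"
      using \<F>(1) by blast
    moreover have "uniformly_bounded X ?\<V>"
      unfolding uniformly_bounded_iff using D \<F>(3) by blast
    moreover have "R_disjoint X (R i) ?\<V>"
      unfolding R_disjoint_def
    proof (intro ballI impI)
      fix U V x y
      assume UV: "U \<in> ?\<V>" "V \<in> ?\<V>" "U \<noteq> V" "x \<in> U" "y \<in> V"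
      then obtain B B' where B: "B \<in> \<U> i" "U \<in> \<F> B" "B' \<in> \<U> i" "V \<in> \<F> B'"
        by blast
      \<comment> \<open>Pieces of the same preimage were separated by merging; pieces of different
        preimages are separated by the choice of \<open>S i\<close>.\<close>
      show "R i \<le> mdist X x y"
      proof (cases "B = B'")
        case True
        then show ?thesis
          using UV B by (intro R_disjointD[OF \<F>(2)[OF B(1)], of U V]) simp_all
      next
        case False
        have xy: "x \<in> mspace X" "f x \<in> B" "y \<in> mspace X" "f y \<in> B'"
          using \<F>(1)[of B] \<F>(1)[of B'] B UV by blast+
        then have "S i \<le> mdist Y (f x) (f y)"
          using R_disjointD[of Y "S i" "\<U> i" B B'] \<U>[OF i] B False by simp
        then show ?thesis
          using E[of "R i" x y] xy S(3)[of i] Ri by linarith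
      qed
    qed
    moreover have "f -` \<Union>(\<U> i) \<inter> mspace X \<subseteq> \<Union>?\<V>"
      using \<F>(1) by blast
    ultimately show ?thesis
      by - (intro exI[of _ ?\<V>] conjI)
  qed
  then have "\<forall>i. \<exists>\<V>. i < m \<longrightarrow> \<V> \<subseteq> Pow (mspace X) \<and> uniformly_bounded X \<V> \<and>
      R_disjoint X (R i) \<V> \<and> f -` \<Union>(\<U> i) \<inter> mspace X \<subseteq> \<Union>\<V>"
    by simp
  from choice[OF this] obtain \<V> where
    \<V>: "\<forall>i. i < m \<longrightarrow> \<V> i \<subseteq> Pow (mspace X) \<and> uniformly_bounded X (\<V> i) \<and>
      R_disjoint X (R i) (\<V> i) \<and> f -` \<Union>(\<U> i) \<inter> mspace X \<subseteq> \<Union>(\<V> i)" ..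
  have "mspace X = (\<Union>i<m. \<Union>(\<V> i))"
  proof
    show "mspace X \<subseteq> (\<Union>i<m. \<Union>(\<V> i))"
    proof
      fix x
      assume x: "x \<in> mspace X"
      then have "f x \<in> mspace Y"
        using f by auto
      then obtain i where "i < m" "f x \<in> \<Union>(\<U> i)"
        unfolding cover by auto
      then show "x \<in> (\<Union>i<m. \<Union>(\<V> i))"
        using \<V>[rule_format, of i] x by blast
    qed
  next
    show "(\<Union>i<m. \<Union>(\<V> i)) \<subseteq> mspace X"
    proof (intro UN_least Union_least)
      fix i U
      assume "i \<in> {..<m}" "U \<in> \<V> i"
      then show "U \<subseteq> mspace X"
        using \<V>[rule_format, of i] by auto
    qed
  qed
  with \<V> show "\<exists>m \<U>. (\<forall>i<m. \<U> i \<subseteq> Pow (mspace X) \<and>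
                  uniformly_bounded X (\<U> i) \<and> R_disjoint X (R i) (\<U> i)) \<and>
           mspace X = (\<Union>i<m. \<Union>(\<U> i))"
    by (intro exI[of _ m] exI[of _ \<V>]) simp
qed

section \<open>Sorting points by a gap between thresholds\<close>

text \<open>If all \<open>n\<close> inclusions were strict, then starting from a nonempty set the
  cardinality would exceed \<open>k\<close> at stage \<open>k\<close>, and hence exceed
  \<open>n\<close> at the end.\<close>

lemma chain_of_finite_sets_stationary:
  assumes mono: "\<And>k. k < n \<Longrightarrow> N k \<subseteq> N (Suc k)"
    and fin: "finite (N n)" "card (N n) \<le> n" and ne: "N 0 \<noteq> {}"
  shows "\<exists>k<n. N k = N (Suc k)"
proof (rule ccontr)
  assume "\<not> ?thesis"
  then have psub: "N k \<subset> N (Suc k)" if "k < n" for k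
    using mono that by blast
  \<comment> \<open>Finiteness is given at the top of the chain and passes down to the subsets,
    hence the downward induction.\<close>
  have finite: "finite (N k)" if "k \<le> n" for k
    using that by (induction k rule: inc_induct) (auto simp: fin intro: finite_subset[OF mono])
  have "k < card (N k)" if "k \<le> n" for k
    using that
  proof (induction k)
    case 0
    then show ?case
      using ne finite by (simp add: card_gt_0_iff)
  next
    case (Suc k)
    then show ?case
      using psubset_card_mono[OF finite psub, of k] by simp
  qed
  then show False
    using fin(2) by (meson leD order_refl)
qed

text \<open>For \<open>y\<close> and the members in the space, these are the members that meet the
  open ball of radius \<open>t\<close> about \<open>y\<close>; their number is the multiplicity of
  the family at \<open>y\<close> on the scale \<open>t\<close>.\<close>

definition members_near :: "'a metric \<Rightarrow> 'a set set \<Rightarrow> real \<Rightarrow> 'a \<Rightarrow> 'a set set" where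
  "members_near M \<V> t y = {V \<in> \<V>. \<exists>v\<in>V. mdist M y v < t}"

lemma members_near_mono: "s \<le> t \<Longrightarrow> members_near M \<V> s y \<subseteq> members_near M \<V> t y"
  unfolding members_near_def by force

text \<open>Along the thresholds \<open>t + k * G\<close> with \<open>k \<le> n\<close>, the sets of
  members near \<open>y\<close> form a chain that starts nonempty and ends with at most
  \<open>n\<close> elements, so it is stationary at some \<open>k < n\<close>. For fixed
  \<open>k\<close>, points with different stationary values are told apart by a member that is near
  one of them and, even at the next threshold, not near the other.\<close>

lemma R_disjoint_families_of_multiplicity:
  assumes sub: "\<V> \<subseteq> Pow (mspace M)" and bdd: "uniformly_bounded M \<V>" and "0 < t" "0 < G"
    and mult: "\<forall>y\<in>mspace M. finite (members_near M \<V> (t + n * G) y) \<and>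
                 card (members_near M \<V> (t + n * G) y) \<le> n"
  obtains \<W> :: "nat \<Rightarrow> 'a set set"
  where "\<And>k. \<W> k \<subseteq> Pow (mspace M)" "\<And>k. uniformly_bounded M (\<W> k)"
    "\<And>k. R_disjoint M G (\<W> k)"
    "\<And>y. \<lbrakk>y \<in> mspace M; members_near M \<V> t y \<noteq> {}\<rbrakk> \<Longrightarrow> y \<in> (\<Union>k<n. \<Union>(\<W> k))"
proof -
  define N where "N k = members_near M \<V> (t + real k * G)" for k :: nat
  \<comment> \<open>Agreement at both thresholds \<open>k\<close> and \<open>Suc k\<close> says that
    no member has its distance to \<open>y\<close> in the gap between them.\<close>
  define W where "W k T = {y \<in> mspace M. N k y = T \<and> N (Suc k) y = T}" for k T
  have mono: "N k y \<subseteq> N (Suc k) y" for k y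
    unfolding N_def using \<open>0 < G\<close> by (intro members_near_mono) simp
  obtain D where D: "0 \<le> D" "\<And>V x y. \<lbrakk>V \<in> \<V>; x \<in> V; y \<in> V\<rbrakk> \<Longrightarrow> mdist M x y \<le> D"
    using bdd unfolding uniformly_bounded_iff by metis
  show ?thesis
  \<comment> \<open>The value \<open>T = {}\<close> is left out, since points near no member may be
    arbitrarily far from each other.\<close>
  proof (rule that[of "\<lambda>k. W k ` (- {{}})"])
    show "W k ` (- {{}}) \<subseteq> Pow (mspace M)" for k
      unfolding W_def by blast
    show "uniformly_bounded M (W k ` (- {{}}))" for k
      unfolding uniformly_bounded_iff
    \<comment> \<open>Two points of one class are both within \<open>t + k * G\<close> of a common
      member \<open>V\<close>, and \<open>V\<close> has diameter at most \<open>D\<close>.\<close>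
    proof (intro exI[of _ "D + 2 * (t + real k * G)"] conjI ballI)
      show "0 \<le> D + 2 * (t + real k * G)"
        using D assms by simp
      fix U x y
      assume "U \<in> W k ` (- {{}})" and xy: "x \<in> U" "y \<in> U"
      then obtain V where V: "V \<in> N k x" "V \<in> N k y" and M: "x \<in> mspace M" "y \<in> mspace M"
        unfolding W_def by blast
      then obtain v w where vw: "V \<in> \<V>" "v \<in> V" "w \<in> V" "mdist M x v < t + real k * G"
          "mdist M y w < t + real k * G"
        unfolding N_def members_near_def by auto
      then have "mdist M x y \<le> mdist M x v + mdist M v y"
          "mdist M v y \<le> mdist M v w + mdist M w y"
        using M sub by (intro mdist_triangle; blast)+
      then show "mdist M x y \<le> D + 2 * (t + real k * G)"
        using vw D(2)[of V v w] by (simp add: mdist_commute)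
    qed
    \<comment> \<open>The distances of \<open>x\<close> and \<open>y\<close> to \<open>V\<close> lie
      on opposite sides of a gap of length \<open>G\<close>, and the distance to a set is
      1-Lipschitz.\<close>
    have gap: "G \<le> mdist M x y"
      if V: "V \<in> N k x" "V \<notin> N (Suc k) y" and xy: "x \<in> mspace M" "y \<in> mspace M" for V k x y
    proof -
      obtain v where v: "V \<in> \<V>" "v \<in> V" "mdist M x v < t + real k * G"
        using V(1) unfolding N_def members_near_def by blast
      then have "t + real (Suc k) * G \<le> mdist M y v"
        using V(2) unfolding N_def members_near_def by auto
      also have "mdist M y v \<le> mdist M y x + mdist M x v"
        using xy v sub by (intro mdist_triangle) auto
      finally show ?thesis
        using v by (simp add: algebra_simps mdist_commute)
    qed
    show "R_disjoint M G (W k ` (- {{}}))" for k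
      unfolding R_disjoint_def
    proof (intro ballI impI)
      fix U U' x y
      assume "U \<in> W k ` (- {{}})" "U' \<in> W k ` (- {{}})" "U \<noteq> U'" and xy: "x \<in> U" "y \<in> U'"
      then obtain T T' where T: "x \<in> W k T" "y \<in> W k T'" "T \<noteq> T'"
        by blast
      then have *: "N k x = T" "N (Suc k) x = T" "N k y = T'" "N (Suc k) y = T'"
          "x \<in> mspace M" "y \<in> mspace M"
        unfolding W_def by auto
      from T(3) consider V where "V \<in> T" "V \<notin> T'" | V where "V \<in> T'" "V \<notin> T"
        by blast
      then show "G \<le> mdist M x y"
      proof cases
        case 1
        then show ?thesis
          using gap[of V k x y] * by simp
      next
        case 2
        then show ?thesis
          using gap[of V k y x] * by (simp add: mdist_commute)
      qed
    qed
    fix y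
    assume y: "y \<in> mspace M" "members_near M \<V> t y \<noteq> {}"
    then have ne: "N 0 y \<noteq> {}"
      by (simp add: N_def)
    obtain k where k: "k < n" "N k y = N (Suc k) y"
      using chain_of_finite_sets_stationary[of n "\<lambda>k. N k y"] mono ne bspec[OF mult y(1)]
      unfolding N_def by blast
    \<comment> \<open>The stationary value contains the nonempty set \<open>N 0 y\<close>, so the
      class of \<open>y\<close> is not the omitted one.\<close>
    have "N 0 y \<subseteq> N k y"
      unfolding N_def using \<open>0 < G\<close> by (intro members_near_mono) simp
    then have "N k y \<noteq> {}"
      using ne by blast
    moreover have "y \<in> W k (N k y)"
      using k y by (simp add: W_def)
    ultimately show "y \<in> (\<Union>k<n. \<Union>(W k ` (- {{}})))"
      using k(1) by blast
  qed
qed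

text \<open>Each \<open>A i\<close> meets at most one member, so the indices below \<open>n\<close>
  enumerate all members that meet the union.\<close>

lemma finite_card_members_meeting_Union:
  assumes "\<And>i U V. \<lbrakk>i < n; U \<in> \<U>; V \<in> \<U>; U \<inter> A i \<noteq> {}; V \<inter> A i \<noteq> {}\<rbrakk> \<Longrightarrow> U = V"
  shows "finite {U \<in> \<U>. U \<inter> (\<Union>i<n. A i) \<noteq> {}} \<and> card {U \<in> \<U>. U \<inter> (\<Union>i<n. A i) \<noteq> {}} \<le> n"
proof -
  \<comment> \<open>For an index whose \<open>A i\<close> meets no member, \<open>THE\<close> gives
    an arbitrary value; this is harmless, as only an inclusion is claimed.\<close>
  have *: "{U \<in> \<U>. U \<inter> (\<Union>i<n. A i) \<noteq> {}} \<subseteq> (\<lambda>i. THE U. U \<in> \<U> \<and> U \<inter> A i \<noteq> {}) ` {..<n}"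
  proof
    fix U
    assume "U \<in> {U \<in> \<U>. U \<inter> (\<Union>i<n. A i) \<noteq> {}}"
    then obtain i where i: "i < n" "U \<in> \<U>" "U \<inter> A i \<noteq> {}"
      by blast
    have "(THE U. U \<in> \<U> \<and> U \<inter> A i \<noteq> {}) = U"
    proof (rule the_equality)
      show "V = U" if V: "V \<in> \<U> \<and> V \<inter> A i \<noteq> {}" for V
        by (rule assms[OF i(1) conjunct1[OF V] i(2) conjunct2[OF V] i(3)])
    qed (use i in simp)
    then show "U \<in> (\<lambda>i. THE U. U \<in> \<U> \<and> U \<inter> A i \<noteq> {}) ` {..<n}"
      using i(1) by (intro image_eqI[of _ _ i]) simp_all
  qed
  show ?thesis
    using surj_card_le[OF finite_lessThan *] finite_subset[OF *] by simp
qed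

section \<open>From the domain to the codomain\<close>

text \<open>The images of members of \<open>\<U> i\<close> may overlap, but a ball of radius
  \<open>r i\<close> meets at most \<open>n\<close> of them. Sorting by thresholds turns them into
  \<open>n\<close> families that are \<open>G i\<close>-disjoint, and these fill the block of
  indices from \<open>n * i\<close> to \<open>n * i + n - 1\<close>.\<close>

lemma asymptotic_property_C_pushforward:
  assumes n: "n \<ge> 1" and f: "f \<in> mspace X \<rightarrow> mspace Y" and n1: "coarsely_n_to_1 n X Y f"
    and surj: "coarsely_surjective X Y f" and X: "asymptotic_property_C X"
  shows "asymptotic_property_C Y"
  unfolding asymptotic_property_C_def
proof (intro allI impI)
  fix R :: "nat \<Rightarrow> real"
  assume R: "(\<forall>i. 0 < R i) \<and> strict_mono R"
  have "bornologous X Y f"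
    using n1 by (simp add: coarsely_n_to_1_def)
  then obtain E where E0: "\<And>r. 0 \<le> r \<Longrightarrow> 0 \<le> E r"
    and E: "\<And>r x y. \<lbrakk>0 \<le> r; x \<in> mspace X; y \<in> mspace X; mdist X x y \<le> r\<rbrakk>
           \<Longrightarrow> mdist Y (f x) (f y) \<le> E r"
    using bornologous_control by metis
  obtain C where "\<And>r. 0 \<le> r \<Longrightarrow> 0 \<le> C r"
    and CB: "\<And>r B. \<lbrakk>0 \<le> r; B \<subseteq> mspace Y; \<And>x y. \<lbrakk>x \<in> B; y \<in> B\<rbrakk> \<Longrightarrow> mdist Y x y \<le> r\<rbrakk>
           \<Longrightarrow> \<exists>A :: nat \<Rightarrow> 'a set. f -` B \<inter> mspace X = (\<Union>i<n. A i) \<and>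
                 (\<forall>i<n. \<forall>x\<in>A i. \<forall>y\<in>A i. mdist X x y < C r)"
    by (fact coarsely_n_to_1_control[OF n1])
  \<comment> \<open>The radius of coarse surjectivity becomes the lowest threshold, so every point
    of \<open>Y\<close> is near the image of some member and is reached by the sorting.\<close>
  obtain t where t: "0 < t" "mspace Y \<subseteq> mneighbourhood Y (f ` mspace X) t"
    using surj unfolding coarsely_surjective_def by blast
  have near_image: "\<exists>x\<in>mspace X. mdist Y y (f x) < t" if y: "y \<in> mspace Y" for y
  proof -
    have "y \<in> mneighbourhood Y (f ` mspace X) t"
      using t(2) y by blast
    then consider x where "x \<in> mspace X" "y = f x" | x where "x \<in> mspace X" "y \<in> mball_of Y (f x) t"
      unfolding mneighbourhood_def by blast
    then show ?thesis
    proof cases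
      case 1
      then show ?thesis
        using y t by (intro bexI[of _ x]) (auto simp: mdist_self)
    next
      case 2
      then show ?thesis
        by (intro bexI[of _ x]) (auto simp: mdist_commute)
    qed
  qed
  \<comment> \<open>The index \<open>n * i + n\<close> lies just beyond block \<open>i\<close>, so
    \<open>G i\<close> dominates every term of \<open>R\<close> in that block.\<close>
  define G where "G i = R (n * i + n)" for i
  \<comment> \<open>This is the highest threshold \<open>t + n * G i\<close>, the scale on which the
    multiplicity has to be bounded.\<close>
  define r where "r i = t + real n * G i" for i
  have G: "0 < G i" for i
    using R by (simp add: G_def)
  have r: "0 < r i" for i
    unfolding r_def using t(1) G by (simp add: add_pos_nonneg less_imp_le)
  \<comment> \<open>A ball of radius \<open>r i\<close> has diameter at most \<open>2 * r i\<close>,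
    so points in one piece of its preimage are less than \<open>S i\<close> apart and cannot lie in
    distinct members of \<open>\<U> i\<close>.\<close>
  obtain S :: "nat \<Rightarrow> real" where S: "strict_mono S" "\<And>i. 0 < S i" "\<And>i. C (2 * r i) < S i"
    using strict_mono_pos_above[of "\<lambda>i. C (2 * r i)"] by metis
  obtain m \<U> where \<U>: "\<And>i. i < m \<Longrightarrow> \<U> i \<subseteq> Pow (mspace X) \<and>
         uniformly_bounded X (\<U> i) \<and> R_disjoint X (S i) (\<U> i)"
    and cover: "mspace X = (\<Union>i<m. \<Union>(\<U> i))"
    by (fact asymptotic_property_CE[OF X S(2,1)])
  have "\<exists>\<W> :: nat \<Rightarrow> 'b set set. \<forall>k. \<W> k \<subseteq> Pow (mspace Y) \<and> uniformly_bounded Y (\<W> k) \<and>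
          R_disjoint Y (G i) (\<W> k) \<and>
          (\<forall>x\<in>\<Union>(\<U> i). \<forall>y\<in>mspace Y. mdist Y y (f x) < t \<longrightarrow> y \<in> (\<Union>k<n. \<Union>(\<W> k)))"
    if i: "i < m" for i
  proof -
    let ?\<V> = "(`) f ` \<U> i"
    have sub: "?\<V> \<subseteq> Pow (mspace Y)"
      using \<U>[OF i] f by blast
    obtain d where d: "0 \<le> d" "\<And>U x y. \<lbrakk>U \<in> \<U> i; x \<in> U; y \<in> U\<rbrakk> \<Longrightarrow> mdist X x y \<le> d"
      using \<U>[OF i] unfolding uniformly_bounded_iff by metis
    have bdd: "uniformly_bounded Y ?\<V>"
      unfolding uniformly_bounded_iff
    proof (intro exI[of _ "E d"] conjI ballI E0 d)
      fix V u v
      assume "V \<in> ?\<V>" "u \<in> V" "v \<in> V"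
      then obtain U x y where U: "U \<in> \<U> i" "x \<in> U" "y \<in> U" "u = f x" "v = f y"
        by blast
      then have "x \<in> mspace X" "y \<in> mspace X"
        using \<U>[OF i] by blast+
      then show "mdist Y u v \<le> E d"
        using U E d by blast
    qed
    have mult: "\<forall>y\<in>mspace Y. finite (members_near Y ?\<V> (r i) y) \<and>
        card (members_near Y ?\<V> (r i) y) \<le> n"
    proof
      fix y
      assume y: "y \<in> mspace Y"
      let ?B = "mball_of Y y (r i)"
      have "mdist Y u v \<le> 2 * r i" if "u \<in> ?B" "v \<in> ?B" for u v
      proof -
        have "mdist Y u v \<le> mdist Y u y + mdist Y y v"
          using that y by (intro mdist_triangle) auto
        then show ?thesis
          using that by (auto simp: mdist_commute)
      qed
      moreover have "?B \<subseteq> mspace Y"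
        by auto
      ultimately obtain A where A: "f -` ?B \<inter> mspace X = (\<Union>j<n. A j)"
        "\<And>j u v. \<lbrakk>j < n; u \<in> A j; v \<in> A j\<rbrakk> \<Longrightarrow> mdist X u v < C (2 * r i)"
        using CB[of "2 * r i" ?B] r[of i] by (metis less_imp_le mult_pos_pos zero_less_numeral)
      \<comment> \<open>The count is made in \<open>X\<close>, where the members are disjoint, and
        is carried over to the images afterwards.\<close>
      define \<M> where "\<M> = {U \<in> \<U> i. U \<inter> (\<Union>j<n. A j) \<noteq> {}}"
      have \<M>: "finite \<M> \<and> card \<M> \<le> n"
        unfolding \<M>_def
      proof (rule finite_card_members_meeting_Union)
        fix j U V
        assume j: "j < n" and UV: "U \<in> \<U> i" "V \<in> \<U> i" and "U \<inter> A j \<noteq> {}" "V \<inter> A j \<noteq> {}"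
        then obtain u v where uv: "u \<in> U" "u \<in> A j" "v \<in> V" "v \<in> A j"
          by auto
        have "mdist X u v < S i"
          using A(2)[OF j uv(2,4)] S(3)[of i] by simp
        moreover have "R_disjoint X (S i) (\<U> i)"
          using \<U>[OF i] by simp
        ultimately show "U = V"
          using R_disjointD[OF _ UV _ uv(1,3)] by fastforce
      qed
      \<comment> \<open>Distinct members may have equal images, so passing to images can only lower
        the count.\<close>
      have *: "members_near Y ?\<V> (r i) y \<subseteq> (`) f ` \<M>"
      proof
        fix V
        assume "V \<in> members_near Y ?\<V> (r i) y"
        then obtain U x where U: "U \<in> \<U> i" "V = f ` U" "x \<in> U" "mdist Y y (f x) < r i"
          unfolding members_near_def by blast
        then have x: "x \<in> mspace X"
          using \<U>[OF i] by blast
        then have "x \<in> f -` ?B \<inter> mspace X"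
          using U y f by auto
        then have "x \<in> U \<inter> (\<Union>j<n. A j)"
          unfolding A(1) using U(3) by simp
        then have "U \<in> \<M>"
          unfolding \<M>_def using U(1) by auto
        then show "V \<in> (`) f ` \<M>"
          unfolding U(2) by (rule imageI)
      qed
      have "finite (members_near Y ?\<V> (r i) y)"
        using \<M> by (intro finite_subset[OF *]) simp
      moreover have "card (members_near Y ?\<V> (r i) y) \<le> card \<M>"
        using \<M> by (intro surj_card_le[OF _ *]) simp
      ultimately show "finite (members_near Y ?\<V> (r i) y) \<and> card (members_near Y ?\<V> (r i) y) \<le> n"
        using \<M> by simp
    qed
    obtain \<W> :: "nat \<Rightarrow> 'b set set" where \<W>: "\<And>k. \<W> k \<subseteq> Pow (mspace Y)"
      "\<And>k. uniformly_bounded Y (\<W> k)" "\<And>k. R_disjoint Y (G i) (\<W> k)"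
      and cov: "\<And>y. \<lbrakk>y \<in> mspace Y; members_near Y ?\<V> t y \<noteq> {}\<rbrakk> \<Longrightarrow> y \<in> (\<Union>k<n. \<Union>(\<W> k))"
      by (fact R_disjoint_families_of_multiplicity[OF sub bdd t(1) G mult[unfolded r_def]])
    have cov': "y \<in> (\<Union>k<n. \<Union>(\<W> k))"
      if "x \<in> \<Union>(\<U> i)" "y \<in> mspace Y" "mdist Y y (f x) < t" for x y
    proof (rule cov)
      show "members_near Y ?\<V> t y \<noteq> {}"
        using that unfolding members_near_def by blast
    qed fact
    show ?thesis
      by (intro exI[of _ \<W>] allI conjI ballI impI \<W> cov'; assumption)
  qed
  then have "\<forall>i. \<exists>\<W> :: nat \<Rightarrow> 'b set set. i < m \<longrightarrow> (\<forall>k. \<W> k \<subseteq> Pow (mspace Y) \<and>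
          uniformly_bounded Y (\<W> k) \<and> R_disjoint Y (G i) (\<W> k) \<and>
          (\<forall>x\<in>\<Union>(\<U> i). \<forall>y\<in>mspace Y. mdist Y y (f x) < t \<longrightarrow> y \<in> (\<Union>k<n. \<Union>(\<W> k))))"
    by simp
  from choice[OF this] obtain \<W> :: "nat \<Rightarrow> nat \<Rightarrow> 'b set set" where
    H: "\<forall>i. i < m \<longrightarrow> (\<forall>k. \<W> i k \<subseteq> Pow (mspace Y) \<and>
          uniformly_bounded Y (\<W> i k) \<and> R_disjoint Y (G i) (\<W> i k) \<and>
          (\<forall>x\<in>\<Union>(\<U> i). \<forall>y\<in>mspace Y. mdist Y y (f x) < t \<longrightarrow> y \<in> (\<Union>k<n. \<Union>(\<W> i k))))" ..
  have \<W>: "\<W> i k \<subseteq> Pow (mspace Y) \<and> uniformly_bounded Y (\<W> i k) \<and> R_disjoint Y (G i) (\<W> i k)"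
    if "i < m" for i k
    using H that by simp
  have cov: "y \<in> (\<Union>k<n. \<Union>(\<W> i k))"
    if "i < m" "x \<in> \<Union>(\<U> i)" "y \<in> mspace Y" "mdist Y y (f x) < t" for i x y
    by (rule H[rule_format, OF that(1), THEN conjunct2, THEN conjunct2, THEN conjunct2,
          rule_format, OF that(2-4)])
  \<comment> \<open>Division with remainder by \<open>n\<close> lists the families
    \<open>\<W> i k\<close> with \<open>k < n\<close> block after block, at index
    \<open>n * i + k\<close>.\<close>
  let ?\<Z> = "\<lambda>q. \<W> (q div n) (q mod n)"
  have Z: "?\<Z> q \<subseteq> Pow (mspace Y) \<and> uniformly_bounded Y (?\<Z> q) \<and> R_disjoint Y (R q) (?\<Z> q)"
    if "q < n * m" for q
  proof -
    have "q div n < m"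
      using that by (simp add: less_mult_imp_div_less mult.commute)
    moreover have "R q \<le> G (q div n)"
    proof -
      have "q \<le> n * (q div n) + n"
        using n mod_less_divisor[of n q] mult_div_mod_eq[of n q] by linarith
      then show ?thesis
        unfolding G_def using R by (simp add: strict_mono_less_eq)
    qed
    ultimately show ?thesis
      using \<W>[of "q div n" "q mod n"] R_disjoint_antimono by blast
  qed
  have "mspace Y = (\<Union>q<n * m. \<Union>(?\<Z> q))"
  proof
    show "mspace Y \<subseteq> (\<Union>q<n * m. \<Union>(?\<Z> q))"
    proof
      fix y
      assume y: "y \<in> mspace Y"
      then obtain x where x: "x \<in> mspace X" "mdist Y y (f x) < t"
        using near_image by blast
      from x(1) obtain i where i: "i < m" "x \<in> \<Union>(\<U> i)"
        unfolding cover by auto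
      then obtain k where k: "k < n" "y \<in> \<Union>(\<W> i k)"
        using cov[OF i y x(2)] by auto
      have "n * i + k < n * Suc i"
        using k by simp
      also have "\<dots> \<le> n * m"
        using i by (intro mult_le_mono2) simp
      finally have "n * i + k < n * m" .
      moreover have "y \<in> \<Union>(?\<Z> (n * i + k))"
        using k by simp
      ultimately show "y \<in> (\<Union>q<n * m. \<Union>(?\<Z> q))"
        by blast
    qed
  next
    show "(\<Union>q<n * m. \<Union>(?\<Z> q)) \<subseteq> mspace Y"
    proof (intro UN_least Union_least)
      fix q U
      assume "q \<in> {..<n * m}" "U \<in> ?\<Z> q"
      then show "U \<subseteq> mspace Y"
        using Z[of q] by auto
    qed
  qed
  with Z show "\<exists>m \<U>. (\<forall>i<m. \<U> i \<subseteq> Pow (mspace Y) \<and>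
                  uniformly_bounded Y (\<U> i) \<and> R_disjoint Y (R i) (\<U> i)) \<and>
           mspace Y = (\<Union>i<m. \<Union>(\<U> i))"
    by (intro exI[of _ "n * m"] exI[of _ ?\<Z>]) simp
qed

theorem corollary6p5:
  fixes X :: "'a metric" and Y :: "'b metric" and f :: "'a \<Rightarrow> 'b" and n :: nat
  assumes "n \<ge> 1"
    and "f \<in> mspace X \<rightarrow> mspace Y"
    and "coarsely_n_to_1 n X Y f"
    and "coarsely_surjective X Y f"
  shows "asymptotic_property_C X \<longleftrightarrow> asymptotic_property_C Y"
  using asymptotic_property_C_pullback[OF assms(2,3)]
    asymptotic_property_C_pushforward[OF assms] by blast

end
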